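(* Let $|q|<1$. Then \[ \sum_{n\geq 0} \frac{q^{2n^2}\prod_{j=1}^n (1+3q^{2j-1}+q^{4j-2})}{(q^2;q^2)_{2n}}= \frac{1}{(q^2;q^2)_\infty}\sum_{n\geq 0} q^{3n^2}(F_{2n+1}+F_{2n-1}), \] and \[ \sum_{n\geq 0} \frac{q^{2n^2}\prod_{j=1}^n (1-3q^{2j-1}+q^{4j-2})}{(q^2;q^2)_{2n}}= \frac{1}{(q^2;q^2)_\infty}\Big(1+\sum_{n\geq 1} (-1)^n q^{3n^2}L_{2n}\Big). \]
   Context: $(a;q)_n=\prod_{k=0}^{n-1}(1-aq^k)$, $(a;q)_\infty=\prod_{k\ge0}(1-aq^k)$. $F_n$ are the Fibonacci numbers ($F_0=0,F_1=1,F_n=F_{n-1}+F_{n-2}$) and $L_n$ the Lucas numbers ($L_0=2,L_1=1,L_n=L_{n-1}+L_{n-2}$). In the first sum, $F_{-1}$ is taken to be $0$. *)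

theory Defs
  imports "HOL-Analysis.Analysis" "HOL-Number_Theory.Fib"
begin

definition qpoch :: "complex \<Rightarrow> complex \<Rightarrow> nat \<Rightarrow> complex" where
  "qpoch a q n = (\<Prod>k<n. 1 - a * q ^ k)"

definition qpoch_inf :: "complex \<Rightarrow> complex \<Rightarrow> complex" where
  "qpoch_inf a q = (\<Prod>k. 1 - a * q ^ k)"

lemma qpoch_inf_has_prod:
  assumes "norm q < 1"
  shows "(\<lambda>k. 1 - a * q ^ k) has_prod qpoch_inf a q"
proof -
  have "summable (\<lambda>k. norm (- a * q ^ k))"
    using assms by (simp add: norm_mult norm_power summable_mult summable_geometric)
  then have "convergent_prod (\<lambda>k. 1 + (- a * q ^ k))"
    by (intro abs_convergent_prod_imp_convergent_prod summable_imp_abs_convergent_prod) simp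
  then show ?thesis
    unfolding qpoch_inf_def by (simp add: convergent_prod_has_prod)
qed

fun lucas :: "nat \<Rightarrow> nat" where
  "lucas 0 = 2"
| "lucas (Suc 0) = 1"
| "lucas (Suc (Suc n)) = lucas (Suc n) + lucas n"

text \<open>Fibonacci numbers at integer indices, with the value \<open>0\<close> at every negative index. This
  is not the usual extension by the recurrence, which would give \<open>F\<^sub>-\<^sub>1 = 1\<close>.\<close>

definition fib_int :: "int \<Rightarrow> nat" where
  "fib_int k = (if k < 0 then 0 else fib (nat k))"

end

theory Submission
  imports Defs
begin

text \<open>Write \<open>Q = q\<^sup>2\<close>. The sequence \<open>a k = L\<^sub>2\<^sub>|\<^sub>k\<^sub>| / 2\<close>, with signs \<open>(-1)\<^sup>k\<close> for the second
  identity, satisfies \<open>a (k + 1) + a (k - 1) = \<plusminus>3 a k\<close> over all integers, so it can replace the powers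
  \<open>z\<^sup>k\<close> in the finite Jacobi triple product: the \<open>n\<close>-th summand on the left is \<open>q\<close> to the power
  \<open>2n\<^sup>2\<close> times the sum over \<open>|k| \<le> n\<close> of \<open>a k\<close> times \<open>q\<close> to the power \<open>k\<^sup>2\<close>, divided by
  \<open>(Q;Q)\<^sub>n\<^sub>-\<^sub>k (Q;Q)\<^sub>n\<^sub>+\<^sub>k\<close>. After interchanging the sums, the sum over \<open>n\<close> is Cauchy's Durfee
  rectangle series, whose value \<open>1 / (Q;Q)\<^sub>\<infinity>\<close> does not depend on the excess \<open>j = 2k\<close> of the
  rectangle. For that series \<open>S j\<close>, the differences \<open>D j = S j - S (j + 1)\<close> satisfy
  \<open>D j = - Q\<^sup>j\<^sup>+\<^sup>1 D (j + 1)\<close> and tend to \<open>0\<close>, hence vanish, and \<open>S j\<close> tends to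
  \<open>1 / (Q;Q)\<^sub>\<infinity>\<close>.\<close>

section \<open>Reciprocal q-factorials\<close>

text \<open>Setting \<open>1 / (Q;Q)\<^sub>m = 0\<close> for \<open>m < 0\<close> is the convention under which
  \<open>1 / (Q;Q)\<^sub>m\<^sub>-\<^sub>1 = (1 - Q\<^sup>m) / (Q;Q)\<^sub>m\<close> remains true at \<open>m = 0\<close>.\<close>

definition inv_qfact :: "complex \<Rightarrow> int \<Rightarrow> complex" where
  "inv_qfact Q m = (if m < 0 then 0 else 1 / qpoch Q Q (nat m))"

lemma one_minus_power_Suc_nonzero:
  fixes Q :: complex
  assumes "norm Q < 1"
  shows "1 - Q * Q ^ k \<noteq> 0"
proof
  assume "1 - Q * Q ^ k = 0"
  then have "norm (Q ^ Suc k) = 1"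
    by (metis eq_iff_diff_eq_0 norm_one power_Suc)
  moreover have "norm (Q ^ Suc k) < 1"
    unfolding norm_power using assms by (simp add: power_less_one_iff del: power_Suc)
  ultimately show False by simp
qed

lemma qpoch_nonzero: "norm Q < 1 \<Longrightarrow> qpoch Q Q n \<noteq> 0"
  unfolding qpoch_def prod_zero_iff[OF finite_lessThan]
  using one_minus_power_Suc_nonzero by blast

lemma qpoch_Suc: "qpoch a Q (Suc n) = qpoch a Q n * (1 - a * Q ^ n)"
  by (simp add: qpoch_def)

lemma inv_qfact_0: "inv_qfact Q 0 = 1"
  by (simp add: inv_qfact_def qpoch_def)

lemma inv_qfact_diff_1:
  assumes "norm Q < 1"
  shows "inv_qfact Q (int m - 1) = (1 - Q ^ m) * inv_qfact Q (int m)"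
proof (cases m)
  case 0
  then show ?thesis by (simp add: inv_qfact_def)
next
  case (Suc l)
  then show ?thesis
    using one_minus_power_Suc_nonzero[OF assms, of l] qpoch_nonzero[OF assms, of l]
    by (simp add: inv_qfact_def qpoch_Suc nat_add_distrib field_simps)
qed

text \<open>The truncated \<open>m - 1\<close> does no harm: at \<open>m = 0\<close> the factor
  \<open>1 - Q ^ m\<close> is already 0.\<close>

lemma inv_qfact_diff_2:
  assumes "norm Q < 1"
  shows "inv_qfact Q (int m - 2) = (1 - Q ^ m) * (1 - Q ^ (m - 1)) * inv_qfact Q (int m)"
proof (cases m)
  case 0
  then show ?thesis by (simp add: inv_qfact_def)
next
  case (Suc l)
  then have "inv_qfact Q (int m - 2) = inv_qfact Q (int l - 1)" by simp
  also have "\<dots> = (1 - Q ^ l) * inv_qfact Q (int m - 1)"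
    using Suc by (simp add: inv_qfact_diff_1[OF assms])
  also have "\<dots> = (1 - Q ^ m) * (1 - Q ^ (m - 1)) * inv_qfact Q (int m)"
    unfolding inv_qfact_diff_1[OF assms] using Suc by simp
  finally show ?thesis .
qed

text \<open>A product convergent in the sense of \<open>has_prod\<close> vanishes only if one of its
  factors does.\<close>

lemma qpoch_inf_nonzero:
  assumes "norm Q < 1"
  shows "qpoch_inf Q Q \<noteq> 0"
proof
  assume "qpoch_inf Q Q = 0"
  then have "0 \<in> range (\<lambda>k. 1 - Q * Q ^ k)"
    by (simp only: has_prod_eq_0_iff[OF qpoch_inf_has_prod[OF assms, of Q]])
  then obtain k where "0 = 1 - Q * Q ^ k"
    by (rule rangeE)
  then show False
    using one_minus_power_Suc_nonzero[OF assms, of k] by (simp only: not_True_eq_False)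
qed

lemma inv_qfact_tendsto:
  assumes "norm Q < 1"
  shows "(\<lambda>n. inv_qfact Q (int n)) \<longlonglongrightarrow> 1 / qpoch_inf Q Q"
proof -
  have "(\<lambda>n. qpoch Q Q n) \<longlonglongrightarrow> qpoch_inf Q Q"
    unfolding qpoch_def by (rule has_prod_imp_tendsto'[OF qpoch_inf_has_prod[OF assms]])
  then show ?thesis
    unfolding inv_qfact_def using qpoch_inf_nonzero[OF assms] by (auto intro!: tendsto_intros)
qed

text \<open>The values at nonnegative indices converge and the others are 0. The uniform
  \<open>M\<close> dominates both the Durfee series and the later double series.\<close>

lemma inv_qfact_bounded:
  assumes "norm Q < 1"
  obtains M where "M > 0" "\<And>m. norm (inv_qfact Q m) \<le> M"
proof -
  have "Bseq (\<lambda>n. inv_qfact Q (int n))"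
    using inv_qfact_tendsto[OF assms] convergentI convergent_imp_Bseq by blast
  then obtain M where M: "M > 0" "\<And>n. norm (inv_qfact Q (int n)) \<le> M"
    by (auto elim: BseqE)
  have "norm (inv_qfact Q m) \<le> M" for m
  proof (cases "m < 0")
    case True
    then show ?thesis using M(1) by (simp add: inv_qfact_def)
  next
    case False
    then show ?thesis using M(2)[of "nat m"] by simp
  qed
  with M(1) show thesis by (rule that)
qed

text \<open>The term is \<open>(K * r ^ n) ^ n\<close> with a base tending to 0, so the square in
  the exponent beats any geometric growth.\<close>

lemma summable_power_times_square_power:
  fixes r K :: real
  assumes "0 \<le> r" "r < 1" "0 \<le> K"
  shows "summable (\<lambda>n. K ^ n * r ^ n\<^sup>2)"
proof (rule summable_comparison_test_ev)
  have "(\<lambda>n. K * r ^ n) \<longlonglongrightarrow> K * 0"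
    using assms by (intro tendsto_intros) auto
  then have "eventually (\<lambda>n. K * r ^ n < 1 / 2) sequentially"
    by (rule order_tendstoD) simp
  then show "eventually (\<lambda>n. norm (K ^ n * r ^ n\<^sup>2) \<le> (1 / 2) ^ n) sequentially"
  proof eventually_elim
    case (elim n)
    have "K ^ n * r ^ n\<^sup>2 = (K * r ^ n) ^ n"
      by (simp add: power_mult_distrib power2_eq_square power_mult)
    also have "\<dots> \<le> (1 / 2) ^ n"
      using elim assms by (intro power_mono) auto
    finally show ?case using assms by simp
  qed
  show "summable (\<lambda>n. (1 / 2 :: real) ^ n)" by (simp add: summable_geometric)
qed

section \<open>Durfee rectangles\<close>

text \<open>Combinatorially, the \<open>m\<close>-th term generates the partitions for which
  \<open>m\<close> is the largest number such that \<open>m\<close> rows by \<open>m + j\<close>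
  columns fit into the diagram. The proof is analytic and varies \<open>j\<close>.\<close>

lemma durfee_rectangle_sums:
  fixes Q :: complex
  assumes "norm Q < 1"
  shows "(\<lambda>m. Q ^ (m\<^sup>2 + m * j) * inv_qfact Q (int m) * inv_qfact Q (int (m + j)))
           sums (1 / qpoch_inf Q Q)"
proof -
  define t where
    "t j m = Q ^ (m\<^sup>2 + m * j) * inv_qfact Q (int m) * inv_qfact Q (int (m + j))" for j m
  define S where "S j = suminf (t j)" for j
  obtain M where M: "M > 0" "\<And>m. norm (inv_qfact Q m) \<le> M"
    using inv_qfact_bounded[OF assms] by blast
  \<comment> \<open>Being free of \<open>j\<close>, this bound also serves as the majorant in
    Tannery's theorem.\<close>
  have t_bound: "norm (t j m) \<le> M * M * norm Q ^ m\<^sup>2" for j m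
  proof -
    have "norm (t j m) = norm Q ^ (m\<^sup>2 + m * j) *
        (norm (inv_qfact Q (int m)) * norm (inv_qfact Q (int (m + j))))"
      by (simp add: t_def norm_mult norm_power mult.assoc)
    also have "\<dots> \<le> norm Q ^ m\<^sup>2 * (M * M)"
      using assms M by (intro mult_mono power_decreasing) auto
    finally show ?thesis by (simp add: mult_ac)
  qed
  have bound_summable: "summable (\<lambda>m. M * M * norm Q ^ m\<^sup>2)"
    using summable_power_times_square_power[of "norm Q" 1] assms
    by (intro summable_mult) simp
  have t_summable: "summable (t j)" for j
    by (rule summable_comparison_test'[OF bound_summable, of 0]) (rule t_bound)
  have S_tendsto: "S \<longlonglongrightarrow> 1 / qpoch_inf Q Q"
  proof -
    \<comment> \<open>As \<open>j\<close> grows only the term \<open>m = 0\<close> survives, since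
      every other term carries at least a factor \<open>Q ^ j\<close>.\<close>
    define b where "b m = (if m = 0 then 1 / qpoch_inf Q Q else 0)" for m :: nat
    have lim: "(\<lambda>j. t j m) \<longlonglongrightarrow> b m" for m
    proof (cases "m = 0")
      case True
      then show ?thesis
        using inv_qfact_tendsto[OF assms] by (simp add: t_def b_def inv_qfact_0)
    next
      case False
      have "(\<lambda>j. M * M * norm Q ^ j) \<longlonglongrightarrow> M * M * 0"
        using assms by (intro tendsto_intros) auto
      then have lim0: "(\<lambda>j. M * M * norm Q ^ j) \<longlonglongrightarrow> 0" by simp
      have le: "norm (t j m) \<le> M * M * norm Q ^ j" for j
      proof -
        have "j \<le> m\<^sup>2 + m * j" using False by (simp add: trans_le_add2)
        moreover have "norm (t j m) = norm Q ^ (m\<^sup>2 + m * j) *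
            (norm (inv_qfact Q (int m)) * norm (inv_qfact Q (int (m + j))))"
          by (simp add: t_def norm_mult norm_power mult.assoc)
        ultimately have "norm (t j m) \<le> norm Q ^ j * (M * M)"
          using assms M by (auto intro!: mult_mono power_decreasing)
        then show ?thesis by (simp add: mult_ac)
      qed
      have "(\<lambda>j. t j m) \<longlonglongrightarrow> 0"
        by (rule Lim_null_comparison[OF _ lim0]) (simp add: le)
      then show ?thesis using False by (simp add: b_def)
    qed
    have "eventually (\<lambda>(m, j). norm (t j m) \<le> M * M * norm Q ^ m\<^sup>2)
        (at_top \<times>\<^sub>F sequentially)"
      using t_bound by (intro always_eventually) auto
    from tannerys_theorem[OF lim this bound_summable]
    have "(\<lambda>j. suminf (\<lambda>m. t j m)) \<longlonglongrightarrow> suminf b"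
      by simp
    moreover have "suminf b = 1 / qpoch_inf Q Q"
      using suminf_finite[of "{0}" b] by (simp add: b_def)
    ultimately show ?thesis by (simp add: S_def[abs_def])
  qed
  define D where "D j = S j - S (Suc j)" for j
  have D_rec: "D j = - (Q ^ Suc j * D (Suc j))" for j
  proof -
    \<comment> \<open>Over a common denominator the difference has the factor
      \<open>1 - Q ^ m - Q ^ (m + Suc j)\<close>. The part \<open>1 - Q ^ m\<close> goes into
      \<open>u\<close>: it vanishes at \<open>m = 0\<close>, and after shifting \<open>m\<close> it
      cancels the last factor of a q-factorial, which yields the series for
      \<open>j + 2\<close>.\<close>
    define u where "u m = Q ^ (m\<^sup>2 + m * j) * (1 - Q ^ m) *
        inv_qfact Q (int m) * inv_qfact Q (int (m + Suc j))" for m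
    have split: "t j m - t (Suc j) m = u m - Q ^ Suc j * t (Suc j) m" for m
    proof -
      have step: "inv_qfact Q (int (m + j)) =
          (1 - Q ^ (m + Suc j)) * inv_qfact Q (int (m + Suc j))"
        using inv_qfact_diff_1[OF assms, of "m + Suc j"] by simp
      show ?thesis
        unfolding t_def u_def step by (simp add: power_add algebra_simps)
    qed
    have shift: "u (Suc m) = Q ^ Suc j * t (Suc (Suc j)) m" for m
    proof -
      have "inv_qfact Q (int m) = (1 - Q ^ Suc m) * inv_qfact Q (int (Suc m))"
        using inv_qfact_diff_1[OF assms, of "Suc m"] by simp
      moreover have "(Suc m)\<^sup>2 + Suc m * j = Suc j + (m\<^sup>2 + m * Suc (Suc j))"
        by (simp add: power2_eq_square algebra_simps)
      ultimately show ?thesis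
        unfolding t_def u_def by (simp add: power_add)
    qed
    have "(\<lambda>m. t j m - t (Suc j) m) sums (S j - S (Suc j))"
      unfolding S_def by (intro sums_diff summable_sums t_summable)
    moreover have "(\<lambda>m. u m - Q ^ Suc j * t (Suc j) m) sums
        (Q ^ Suc j * S (Suc (Suc j)) - Q ^ Suc j * S (Suc j))"
    proof (intro sums_diff)
      have "(\<lambda>m. u (Suc m)) sums (Q ^ Suc j * S (Suc (Suc j)))"
        unfolding shift S_def by (intro sums_mult summable_sums t_summable)
      then show "u sums (Q ^ Suc j * S (Suc (Suc j)))"
        by (subst (asm) sums_Suc_iff) (simp add: u_def)
      show "(\<lambda>m. Q ^ Suc j * t (Suc j) m) sums (Q ^ Suc j * S (Suc j))"
        unfolding S_def by (intro sums_mult summable_sums t_summable)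
    qed
    ultimately show ?thesis
      unfolding D_def split using sums_unique2 by (fastforce simp: algebra_simps)
  qed
  \<comment> \<open>The recurrence is read from the tail: each \<open>D j\<close> is bounded by all
    later ones, which tend to 0.\<close>
  have D_mono: "norm (D j) \<le> norm (D (j + n))" for j n
  proof (induction n)
    case (Suc n)
    have "norm (D (j + n)) = norm Q ^ Suc (j + n) * norm (D (Suc (j + n)))"
      using D_rec[of "j + n"] by (metis norm_minus_cancel norm_mult norm_power)
    also have "\<dots> \<le> 1 * norm (D (Suc (j + n)))"
      using assms by (intro mult_right_mono power_le_one) auto
    finally show ?case using Suc by simp
  qed simp
  have "D \<longlonglongrightarrow> 1 / qpoch_inf Q Q - 1 / qpoch_inf Q Q"
    unfolding D_def by (intro tendsto_diff S_tendsto LIMSEQ_Suc[OF S_tendsto])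
  then have D_tendsto: "D \<longlonglongrightarrow> 0" by simp
  have "D j = 0" for j
  proof -
    have "(\<lambda>n. norm (D (n + j))) \<longlonglongrightarrow> 0"
      using LIMSEQ_ignore_initial_segment[OF tendsto_norm_zero[OF D_tendsto]] by simp
    then have "norm (D j) \<le> 0"
      by (rule LIMSEQ_le_const) (use D_mono[of j] in \<open>auto simp: add.commute\<close>)
    then show ?thesis by simp
  qed
  then have S_Suc: "S (Suc j) = S j" for j
    by (simp add: D_def)
  have "S j = S 0" for j
    by (induction j) (simp_all add: S_Suc)
  then have "S = (\<lambda>_. S j)" by (metis (no_types) ext)
  then have "S \<longlonglongrightarrow> S j" by (metis tendsto_const)
  then have "S j = 1 / qpoch_inf Q Q"
    using S_tendsto LIMSEQ_unique by blast
  then show ?thesis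
    using summable_sums[OF t_summable[of j]] unfolding S_def t_def by simp
qed

section \<open>A finite triple product\<close>

text \<open>Up to the factor \<open>(Q;Q)_(2n)\<close> with \<open>Q = q^2\<close>, this is
  \<open>q^(k^2)\<close> times the Gaussian binomial coefficient of \<open>2n\<close> over
  \<open>n + k\<close>.\<close>

definition jtp_coeff :: "complex \<Rightarrow> nat \<Rightarrow> int \<Rightarrow> complex" where
  "jtp_coeff q n k = q ^ nat (k\<^sup>2) * inv_qfact (q\<^sup>2) (int n - k) * inv_qfact (q\<^sup>2) (int n + k)"

lemma jtp_coeff_eq_0: "\<bar>k\<bar> > int n \<Longrightarrow> jtp_coeff q n k = 0"
  by (auto simp: jtp_coeff_def inv_qfact_def)

lemma jtp_coeff_minus: "jtp_coeff q n (- k) = jtp_coeff q n k"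
  by (simp add: jtp_coeff_def)

text \<open>This is the recurrence below with its common factor removed. With
  \<open>x = Q ^ u\<close> and \<open>y = Q ^ v\<close> the hypothesis says
  \<open>x * y = Q ^ (2 * n + 2)\<close>, and both sides expand alike. A truncated
  \<open>u - 1\<close> or \<open>v - 1\<close> occurs only next to a factor that is 0.\<close>

lemma jtp_polynomial_identity:
  fixes Q :: complex
  assumes "u + v = 2 * n + 2"
  shows "(1 - Q ^ (2 * n + 1)) * (1 - Q ^ (2 * n + 2)) =
     (1 + Q ^ (2 * n + 1)) * (1 - Q ^ u) * (1 - Q ^ v)
     + Q ^ u * ((1 - Q ^ v) * (1 - Q ^ (v - 1))) + Q ^ v * ((1 - Q ^ u) * (1 - Q ^ (u - 1)))"
proof (cases "u = 0 \<or> v = 0")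
  case True
  then show ?thesis using assms by (auto simp: algebra_simps)
next
  case False
  then obtain u' v' where uv: "u = Suc u'" "v = Suc v'"
    by (meson not0_implies_Suc)
  then have n: "2 * n = u' + v'" using assms by simp
  show ?thesis
    unfolding n uv by (simp add: power_add) (simp add: algebra_simps)
qed

text \<open>Comparison of the coefficients of \<open>z^k\<close> when the triple product gains
  \<open>(1 + z q^(2n+1)) (1 + q^(2n+1) / z)\<close>; the factors on the left are the two new ones
  of \<open>(Q;Q)_(2n+2)\<close>.\<close>

lemma jtp_coeff_Suc:
  assumes "norm q < 1" "\<bar>k\<bar> \<le> int n + 1"
  shows "(1 - (q\<^sup>2) ^ (2 * n + 1)) * (1 - (q\<^sup>2) ^ (2 * n + 2)) * jtp_coeff q (Suc n) k =
     (1 + q ^ (4 * n + 2)) * jtp_coeff q n k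
     + q ^ (2 * n + 1) * (jtp_coeff q n (k - 1) + jtp_coeff q n (k + 1))"
proof -
  define Q where "Q = q\<^sup>2"
  have Q: "norm Q < 1"
    using assms(1) by (simp add: Q_def norm_power power_less_one_iff)
  define u v where "u = nat (int n + 1 - k)" and "v = nat (int n + 1 + k)"
  have u: "int u = int n + 1 - k" and v: "int v = int n + 1 + k"
    using assms(2) by (auto simp: u_def v_def)
  have uv: "u + v = 2 * n + 2" using u v by linarith
  \<comment> \<open>\<open>I\<close> is the coefficient for \<open>Suc n\<close>; the three others
    are multiples of it, as their indices lie one or two below \<open>u\<close> and
    \<open>v\<close>.\<close>
  define I where "I = q ^ nat (k\<^sup>2) * inv_qfact Q (int u) * inv_qfact Q (int v)"
  have c0: "jtp_coeff q (Suc n) k = I"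
    by (simp add: jtp_coeff_def I_def u v Q_def algebra_simps)
  have c1: "jtp_coeff q n k = (1 - Q ^ u) * (1 - Q ^ v) * I"
  proof -
    have "int n - k = int u - 1" "int n + k = int v - 1" using u v by auto
    then show ?thesis
      unfolding jtp_coeff_def Q_def[symmetric] I_def
      by (simp add: inv_qfact_diff_1[OF Q] mult_ac)
  qed
  have c2: "q ^ (2 * n + 1) * jtp_coeff q n (k - 1) = Q ^ u * ((1 - Q ^ v) * (1 - Q ^ (v - 1))) * I"
  proof -
    have idx: "int n - (k - 1) = int u" "int n + (k - 1) = int v - 2" using u v by auto
    have pow: "q ^ (2 * n + 1) * q ^ nat ((k - 1)\<^sup>2) = Q ^ u * q ^ nat (k\<^sup>2)"
    proof -
      have "int (nat ((k - 1)\<^sup>2)) = (k - 1)\<^sup>2" by simp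
      also have "\<dots> = k\<^sup>2 - 2 * k + 1"
        by (simp add: power2_eq_square algebra_simps)
      also have "k\<^sup>2 = int (nat (k\<^sup>2))" by simp
      finally have "2 * n + 1 + nat ((k - 1)\<^sup>2) = 2 * u + nat (k\<^sup>2)"
        using u by linarith
      then show ?thesis
        unfolding Q_def by (simp only: power_mult[symmetric] power_add[symmetric])
    qed
    show ?thesis
      unfolding jtp_coeff_def Q_def[symmetric] I_def idx inv_qfact_diff_2[OF Q]
        mult.assoc[symmetric] pow
      by (simp only: mult_ac)
  qed
  have c3: "q ^ (2 * n + 1) * jtp_coeff q n (k + 1) = Q ^ v * ((1 - Q ^ u) * (1 - Q ^ (u - 1))) * I"
  proof -
    have idx: "int n - (k + 1) = int u - 2" "int n + (k + 1) = int v" using u v by auto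
    have pow: "q ^ (2 * n + 1) * q ^ nat ((k + 1)\<^sup>2) = Q ^ v * q ^ nat (k\<^sup>2)"
    proof -
      have "int (nat ((k + 1)\<^sup>2)) = (k + 1)\<^sup>2" by simp
      also have "\<dots> = k\<^sup>2 + 2 * k + 1"
        by (simp add: power2_eq_square algebra_simps)
      also have "k\<^sup>2 = int (nat (k\<^sup>2))" by simp
      finally have "2 * n + 1 + nat ((k + 1)\<^sup>2) = 2 * v + nat (k\<^sup>2)"
        using v by linarith
      then show ?thesis
        unfolding Q_def by (simp only: power_mult[symmetric] power_add[symmetric])
    qed
    show ?thesis
      unfolding jtp_coeff_def Q_def[symmetric] I_def idx inv_qfact_diff_2[OF Q]
        mult.assoc[symmetric] pow
      by (simp only: mult_ac)
  qed
  have q4: "q ^ (4 * n + 2) = Q ^ (2 * n + 1)"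
    unfolding Q_def power_mult[symmetric] by (simp add: algebra_simps)
  show ?thesis
    unfolding distrib_left c2 c3 unfolding c0 c1 q4 Q_def[symmetric]
      jtp_polynomial_identity[OF uv, of Q]
    by (simp add: algebra_simps)
qed

text \<open>For \<open>a k = z\<^sup>k\<close> and \<open>c = z + 1/z\<close> this is the finite form of the Jacobi triple product;
  any bilateral solution of the recurrence can take the place of \<open>z\<^sup>k\<close>.\<close>

lemma finite_triple_product:
  fixes a :: "int \<Rightarrow> complex"
  assumes q: "norm q < 1" and rec: "\<And>k. a (k + 1) + a (k - 1) = c * a k" and a0: "a 0 = 1"
  shows "(\<Prod>j=1..n. 1 + c * q ^ (2 * j - 1) + q ^ (4 * j - 2)) =
     qpoch (q\<^sup>2) (q\<^sup>2) (2 * n) * (\<Sum>k=-int n..int n. a k * jtp_coeff q n k)"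
proof (induction n)
  case 0
  then show ?case by (simp add: a0 jtp_coeff_def inv_qfact_0 qpoch_def)
next
  case (Suc n)
  let ?I = "{-int n..int n}" and ?J = "{-int (Suc n)..int (Suc n)}"
  let ?T = "jtp_coeff q n"
  \<comment> \<open>All three sums may change range freely, since coefficients with
    \<open>|k| > n\<close> are 0.\<close>
  have mid: "(\<Sum>k\<in>?J. a k * ?T k) = (\<Sum>k\<in>?I. a k * ?T k)"
    by (rule sum.mono_neutral_right) (auto simp: jtp_coeff_eq_0)
  have right: "(\<Sum>k\<in>?J. a k * ?T (k - 1)) = (\<Sum>k\<in>?I. a (k + 1) * ?T k)"
  proof -
    have "(\<Sum>k\<in>?I. a (k + 1) * ?T k) = (\<Sum>k\<in>{-int n + 1..int n + 1}. a k * ?T (k - 1))"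
      by (rule sum.reindex_bij_witness[of _ "\<lambda>k. k - 1" "\<lambda>k. k + 1"]) auto
    also have "\<dots> = (\<Sum>k\<in>?J. a k * ?T (k - 1))"
      by (rule sum.mono_neutral_left) (auto simp: jtp_coeff_eq_0)
    finally show ?thesis by simp
  qed
  have left: "(\<Sum>k\<in>?J. a k * ?T (k + 1)) = (\<Sum>k\<in>?I. a (k - 1) * ?T k)"
  proof -
    have "(\<Sum>k\<in>?I. a (k - 1) * ?T k) = (\<Sum>k\<in>{-int n - 1..int n - 1}. a k * ?T (k + 1))"
      by (rule sum.reindex_bij_witness[of _ "\<lambda>k. k + 1" "\<lambda>k. k - 1"]) auto
    also have "\<dots> = (\<Sum>k\<in>?J. a k * ?T (k + 1))"
      by (rule sum.mono_neutral_left) (auto simp: jtp_coeff_eq_0)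
    finally show ?thesis by simp
  qed
  \<comment> \<open>The shifts, moved from the coefficients to \<open>a\<close>, merge into
    multiplication by \<open>c\<close>.\<close>
  have outer: "(\<Sum>k\<in>?I. a (k + 1) * ?T k) + (\<Sum>k\<in>?I. a (k - 1) * ?T k) =
      c * (\<Sum>k\<in>?I. a k * ?T k)"
    by (simp add: sum_distrib_left rec flip: sum.distrib distrib_right mult.assoc)
  have step: "(1 - (q\<^sup>2) ^ (2 * n + 1)) * (1 - (q\<^sup>2) ^ (2 * n + 2)) *
        (\<Sum>k\<in>?J. a k * jtp_coeff q (Suc n) k) =
      (1 + c * q ^ (2 * n + 1) + q ^ (4 * n + 2)) * (\<Sum>k\<in>?I. a k * ?T k)" (is "?E * _ = _")
  proof -
    have "?E * (\<Sum>k\<in>?J. a k * jtp_coeff q (Suc n) k) =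
        (\<Sum>k\<in>?J. a k * (?E * jtp_coeff q (Suc n) k))"
      by (simp add: sum_distrib_left mult_ac)
    also have "\<dots> = (\<Sum>k\<in>?J. (1 + q ^ (4 * n + 2)) * (a k * ?T k) +
        q ^ (2 * n + 1) * (a k * ?T (k - 1)) + q ^ (2 * n + 1) * (a k * ?T (k + 1)))"
    proof (rule sum.cong)
      fix k assume "k \<in> ?J"
      then have "\<bar>k\<bar> \<le> int n + 1" by auto
      then show "a k * (?E * jtp_coeff q (Suc n) k) = (1 + q ^ (4 * n + 2)) * (a k * ?T k) +
          q ^ (2 * n + 1) * (a k * ?T (k - 1)) + q ^ (2 * n + 1) * (a k * ?T (k + 1))"
        unfolding jtp_coeff_Suc[OF q \<open>\<bar>k\<bar> \<le> int n + 1\<close>] by (simp add: algebra_simps)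
    qed simp
    also have "\<dots> = (1 + q ^ (4 * n + 2)) * (\<Sum>k\<in>?I. a k * ?T k) + q ^ (2 * n + 1) *
        ((\<Sum>k\<in>?I. a (k + 1) * ?T k) + (\<Sum>k\<in>?I. a (k - 1) * ?T k))"
      unfolding sum.distrib sum_distrib_left[symmetric] mid left right
      by (simp add: algebra_simps)
    finally show ?thesis
      unfolding outer by (simp add: algebra_simps)
  qed
  have "qpoch (q\<^sup>2) (q\<^sup>2) (2 * Suc n) =
      qpoch (q\<^sup>2) (q\<^sup>2) (2 * n) * ((1 - (q\<^sup>2) ^ (2 * n + 1)) * (1 - (q\<^sup>2) ^ (2 * n + 2)))"
    by (simp add: qpoch_Suc)
  then have "qpoch (q\<^sup>2) (q\<^sup>2) (2 * Suc n) * (\<Sum>k\<in>?J. a k * jtp_coeff q (Suc n) k) =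
      qpoch (q\<^sup>2) (q\<^sup>2) (2 * n) *
        ((1 + c * q ^ (2 * n + 1) + q ^ (4 * n + 2)) * (\<Sum>k\<in>?I. a k * ?T k))"
    by (simp only: mult.assoc step[unfolded mult.assoc])
  also have "\<dots> = (\<Prod>j=1..Suc n. 1 + c * q ^ (2 * j - 1) + q ^ (4 * j - 2))"
    unfolding prod.cl_ivl_Suc Suc.IH by (simp add: mult_ac)
  finally show ?case by simp
qed

lemma sum_symmetric_int:
  fixes f :: "int \<Rightarrow> complex"
  assumes "\<And>k. f (- k) = f k"
  shows "(\<Sum>k=-int n..int n. f k) = (\<Sum>k\<le>n. (if k = 0 then 1 else 2) * f (int k))"
proof (induction n)
  case (Suc n)
  have "{-int (Suc n)..int (Suc n)} =
      insert (int (Suc n)) (insert (- int (Suc n)) {-int n..int n})"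
    by auto
  then show ?case using Suc.IH assms[of "int (Suc n)"] by simp
qed simp

lemma finite_triple_product_even:
  fixes a :: "int \<Rightarrow> complex"
  assumes q: "norm q < 1" and rec: "\<And>k. a (k + 1) + a (k - 1) = c * a k" and a0: "a 0 = 1"
    and even: "\<And>k. a (- k) = a k"
  shows "(\<Prod>j=1..n. 1 + c * q ^ (2 * j - 1) + q ^ (4 * j - 2)) / qpoch (q\<^sup>2) (q\<^sup>2) (2 * n) =
     (\<Sum>k\<le>n. (if k = 0 then 1 else 2) * a (int k) * jtp_coeff q n (int k))"
proof -
  have "norm (q\<^sup>2) < 1"
    using q by (simp add: norm_power power_less_one_iff)
  moreover have "(\<Sum>k=-int n..int n. a k * jtp_coeff q n k) =
      (\<Sum>k\<le>n. (if k = 0 then 1 else 2) * a (int k) * jtp_coeff q n (int k))"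
    unfolding mult.assoc by (rule sum_symmetric_int) (simp add: even jtp_coeff_minus)
  ultimately show ?thesis
    unfolding finite_triple_product[OF q rec a0] by (simp add: qpoch_nonzero)
qed

section \<open>Summation over the central index\<close>

text \<open>Terms with \<open>n < k\<close> vanish. Putting \<open>n = m + k\<close>, the exponent
  \<open>2n^2 + k^2\<close> becomes \<open>3k^2 + 2(m^2 + 2km)\<close>, which leaves the Durfee
  series of excess \<open>2k\<close>.\<close>

lemma jtp_coeff_sums:
  assumes "norm q < 1"
  shows "(\<lambda>n. q ^ (2 * n\<^sup>2) * jtp_coeff q n (int k))
           sums (q ^ (3 * k\<^sup>2) / qpoch_inf (q\<^sup>2) (q\<^sup>2))"
proof -
  have Q: "norm (q\<^sup>2) < 1"
    using assms by (simp add: norm_power power_less_one_iff)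
  let ?f = "\<lambda>n. q ^ (2 * n\<^sup>2) * jtp_coeff q n (int k)"
  have "?f (m + k) = q ^ (3 * k\<^sup>2) * ((q\<^sup>2) ^ (m\<^sup>2 + m * (2 * k)) *
      inv_qfact (q\<^sup>2) (int m) * inv_qfact (q\<^sup>2) (int (m + 2 * k)))" for m
  proof -
    have "nat ((int k)\<^sup>2) = k\<^sup>2"
      by (metis nat_int of_nat_power)
    moreover have "q ^ (2 * (m + k)\<^sup>2) * q ^ k\<^sup>2 =
        q ^ (3 * k\<^sup>2) * (q\<^sup>2) ^ (m\<^sup>2 + m * (2 * k))"
    proof -
      have "2 * (m + k)\<^sup>2 + k\<^sup>2 = 3 * k\<^sup>2 + 2 * (m\<^sup>2 + m * (2 * k))"
        by (simp add: power2_eq_square algebra_simps)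
      then show ?thesis by (simp flip: power_mult power_add)
    qed
    moreover have "int (m + k) - int k = int m" "int (m + k) + int k = int (m + 2 * k)"
      by auto
    ultimately show ?thesis
      unfolding jtp_coeff_def by (simp only: mult.assoc[symmetric])
  qed
  then have "(\<lambda>m. ?f (m + k)) sums (q ^ (3 * k\<^sup>2) * (1 / qpoch_inf (q\<^sup>2) (q\<^sup>2)))"
    by (simp only:) (intro sums_mult durfee_rectangle_sums[OF Q])
  then show ?thesis
    by (subst (asm) sums_zero_iff_shift) (auto simp: jtp_coeff_eq_0)
qed

text \<open>An absolutely convergent double series is summed in two orders: its rows are the finite
  triple products, its columns the Durfee series.\<close>

lemma triple_product_sums:
  fixes a :: "int \<Rightarrow> complex"
  assumes q: "norm q < 1" and rec: "\<And>k. a (k + 1) + a (k - 1) = c * a k" and a0: "a 0 = 1"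
    and even: "\<And>k. a (- k) = a k" and growth: "\<And>k. norm (a (int k)) \<le> K ^ k" and "0 \<le> K"
  defines "b \<equiv> \<lambda>k. q ^ (3 * k\<^sup>2) * ((if k = 0 then 1 else 2) * a (int k))"
  shows "summable b"
    and "(\<lambda>n. q ^ (2 * n\<^sup>2) * (\<Prod>j=1..n. 1 + c * q ^ (2 * j - 1) + q ^ (4 * j - 2))
            / qpoch (q\<^sup>2) (q\<^sup>2) (2 * n)) sums (1 / qpoch_inf (q\<^sup>2) (q\<^sup>2) * suminf b)"
proof -
  have Q: "norm (q\<^sup>2) < 1"
    using q by (simp add: norm_power power_less_one_iff)
  define r where "r = norm q"
  have r: "0 \<le> r" "r < 1" using q by (auto simp: r_def)
  define e :: "nat \<Rightarrow> complex" where "e k = (if k = 0 then 1 else 2) * a (int k)" for k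
  have e: "norm (e k) \<le> 2 * K ^ k" for k
    using growth[of k] by (auto simp: e_def norm_mult a0)
  obtain M where M: "M > 0" "\<And>m. norm (inv_qfact (q\<^sup>2) m) \<le> M"
    using inv_qfact_bounded[OF Q] by blast
  define f where "f = (\<lambda>(n, k). e k * (q ^ (2 * n\<^sup>2) * jtp_coeff q n (int k)))"
  \<comment> \<open>Weakening \<open>r^(2n^2)\<close> to \<open>r^(n^2)\<close>, the majorant is a
    product of a function of \<open>n\<close> and one of \<open>k\<close>, so its summability
    reduces to two single series.\<close>
  have f_bound: "norm (f (n, k)) \<le> r ^ n\<^sup>2 * (2 * M * M * (K ^ k * r ^ k\<^sup>2))" for n k
  proof -
    have "nat ((int k)\<^sup>2) = k\<^sup>2" by (metis nat_int of_nat_power)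
    then have "norm (f (n, k)) = norm (e k) * (r ^ (2 * n\<^sup>2) * (r ^ k\<^sup>2 *
        (norm (inv_qfact (q\<^sup>2) (int n - int k)) * norm (inv_qfact (q\<^sup>2) (int n + int k)))))"
      by (simp add: f_def jtp_coeff_def norm_mult norm_power r_def mult.assoc)
    also have "\<dots> \<le> (2 * K ^ k) * (r ^ n\<^sup>2 * (r ^ k\<^sup>2 * (M * M)))"
      using r M \<open>0 \<le> K\<close> by (intro mult_mono e order_refl power_decreasing) auto
    finally show ?thesis by (simp add: mult_ac)
  qed
  have sum_n: "summable (\<lambda>n. r ^ n\<^sup>2)"
    using summable_power_times_square_power[of r 1] r by simp
  have sum_k: "summable (\<lambda>k. 2 * M * M * (K ^ k * r ^ k\<^sup>2))"
    by (intro summable_mult summable_power_times_square_power r \<open>0 \<le> K\<close>)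
  have "(\<lambda>(n, k). r ^ n\<^sup>2 * (2 * M * M * (K ^ k * r ^ k\<^sup>2))) summable_on UNIV \<times> UNIV"
  proof (rule summable_on_SigmaI)
    have "(\<lambda>k. 2 * M * M * (K ^ k * r ^ k\<^sup>2)) summable_on UNIV"
      by (subst summable_on_UNIV_nonneg_real_iff) (use r M \<open>0 \<le> K\<close> sum_k in auto)
    then show "((\<lambda>k. case (n, k) of (n, k) \<Rightarrow> r ^ n\<^sup>2 * (2 * M * M * (K ^ k * r ^ k\<^sup>2))) has_sum
        r ^ n\<^sup>2 * (\<Sum>\<^sub>\<infinity>k. 2 * M * M * (K ^ k * r ^ k\<^sup>2))) UNIV" for n
      unfolding prod.case by (intro has_sum_cmult_right has_sum_infsum)
    show "(\<lambda>n. r ^ n\<^sup>2 * (\<Sum>\<^sub>\<infinity>k. 2 * M * M * (K ^ k * r ^ k\<^sup>2))) summable_on UNIV"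
      by (intro summable_on_cmult_left, subst summable_on_UNIV_nonneg_real_iff)
        (use r sum_n in auto)
  qed (use r M \<open>0 \<le> K\<close> in auto)
  then have "(\<lambda>x. norm (f x)) summable_on UNIV \<times> UNIV"
    by (rule Infinite_Sum.abs_summable_on_comparison_test') (use f_bound in auto)
  then have "f summable_on UNIV \<times> UNIV"
    by (rule Infinite_Sum.abs_summable_summable)
  then obtain s where s: "(f has_sum s) (UNIV \<times> UNIV)"
    by (auto simp: summable_on_def)

  have "((\<lambda>n. \<Sum>k\<le>n. f (n, k)) has_sum s) UNIV"
    by (rule has_sum_SigmaD[OF s], rule has_sum_finite_neutralI)
      (auto simp: f_def jtp_coeff_eq_0)
  then have rows: "(\<lambda>n. \<Sum>k\<le>n. f (n, k)) sums s"
    by (rule has_sum_imp_sums)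
  have row: "(\<Sum>k\<le>n. f (n, k)) =
      q ^ (2 * n\<^sup>2) * (\<Prod>j=1..n. 1 + c * q ^ (2 * j - 1) + q ^ (4 * j - 2))
            / qpoch (q\<^sup>2) (q\<^sup>2) (2 * n)" for n
    unfolding times_divide_eq_right[symmetric] finite_triple_product_even[OF q rec a0 even]
    by (simp add: f_def e_def sum_distrib_left mult_ac)

  have column: "((\<lambda>n. f (n, k)) has_sum b k / qpoch_inf (q\<^sup>2) (q\<^sup>2)) UNIV" for k
  proof (rule norm_summable_imp_has_sum)
    show "summable (\<lambda>n. norm (f (n, k)))"
      by (rule summable_comparison_test'[OF summable_mult2[OF sum_n], of 0])
        (unfold real_norm_def abs_norm_cancel, rule f_bound)
    show "(\<lambda>n. f (n, k)) sums (b k / qpoch_inf (q\<^sup>2) (q\<^sup>2))"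
      using sums_mult[OF jtp_coeff_sums[OF q, of k], of "e k"]
      by (simp add: f_def b_def e_def mult_ac)
  qed
  have swapped: "((\<lambda>(k, n). f (n, k)) has_sum s) (UNIV \<times> UNIV)"
    using s by (subst (asm) has_sum_swap)
  have "((\<lambda>k. b k / qpoch_inf (q\<^sup>2) (q\<^sup>2)) has_sum s) UNIV"
    by (rule has_sum_SigmaD[OF swapped]) (use column in auto)
  then have "(\<lambda>k. b k / qpoch_inf (q\<^sup>2) (q\<^sup>2)) sums s"
    by (rule has_sum_imp_sums)
  \<comment> \<open>Removing the nonzero constant gives convergence of \<open>b\<close>
    itself.\<close>
  from sums_mult[OF this, of "qpoch_inf (q\<^sup>2) (q\<^sup>2)"]
  have "b sums (qpoch_inf (q\<^sup>2) (q\<^sup>2) * s)"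
    using qpoch_inf_nonzero[OF Q] by simp
  then show "summable b" and "(\<lambda>n. q ^ (2 * n\<^sup>2) *
      (\<Prod>j=1..n. 1 + c * q ^ (2 * j - 1) + q ^ (4 * j - 2)) / qpoch (q\<^sup>2) (q\<^sup>2) (2 * n))
      sums (1 / qpoch_inf (q\<^sup>2) (q\<^sup>2) * suminf b)"
    using rows qpoch_inf_nonzero[OF Q] unfolding row
    by (auto simp: sums_iff)
qed

section \<open>Lucas numbers of even index\<close>

text \<open>The origin of the 3 in the products: it is the Lucas number \<open>L_2\<close>.\<close>

lemma lucas_even_rec: "lucas (2 * Suc (Suc m)) + lucas (2 * m) = 3 * lucas (2 * Suc m)"
  by simp

lemma lucas_eq_fib: "lucas (Suc n) = fib (Suc (Suc n)) + fib n"
  by (induction n rule: fib.induct) simp_all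

text \<open>Dropping a nonnegative term of the recurrence bounds successive ratios by 3; the 2 is
  \<open>L_0\<close>.\<close>

lemma lucas_even_le: "lucas (2 * n) \<le> 2 * 3 ^ n"
proof (induction n)
  case (Suc n)
  have "lucas (2 * Suc n) \<le> 3 * lucas (2 * n)"
  proof (cases n)
    case 0
    then show ?thesis by (simp add: numeral_2_eq_2)
  next
    case (Suc m)
    then show ?thesis by simp
  qed
  then show ?case using Suc by simp
qed simp

text \<open>The even extension keeps the recurrence across 0, where it reads
  \<open>2 L_2 = 3 L_0\<close>.\<close>

lemma lucas_even_bilateral_rec:
  "real (lucas (2 * nat \<bar>k + 1\<bar>)) + real (lucas (2 * nat \<bar>k - 1\<bar>)) =
     3 * real (lucas (2 * nat \<bar>k\<bar>))"
proof -
  have pos: "lucas (2 * nat \<bar>k + 1\<bar>) + lucas (2 * nat \<bar>k - 1\<bar>) = 3 * lucas (2 * nat \<bar>k\<bar>)"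
    if "k > 0" for k
  proof -
    define m where "m = nat (k - 1)"
    have "nat \<bar>k + 1\<bar> = Suc (Suc m)" "nat \<bar>k - 1\<bar> = m" "nat \<bar>k\<bar> = Suc m"
      using that by (auto simp: m_def)
    then show ?thesis by (simp only: lucas_even_rec)
  qed
  consider "k > 0" | "k = 0" | "- k > 0" by linarith
  then have "lucas (2 * nat \<bar>k + 1\<bar>) + lucas (2 * nat \<bar>k - 1\<bar>) = 3 * lucas (2 * nat \<bar>k\<bar>)"
  proof cases
    case 1
    then show ?thesis by (rule pos)
  next
    case 2
    then show ?thesis by (simp add: numeral_2_eq_2)
  next
    case 3
    have "\<bar>- k + 1\<bar> = \<bar>k - 1\<bar>" "\<bar>- k - 1\<bar> = \<bar>k + 1\<bar>" by auto
    then show ?thesis using pos[OF 3] by simp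
  qed
  then show ?thesis by linarith
qed

lemma lucas_triple_product_sums:
  fixes q s :: complex
  assumes q: "norm q < 1" and s: "s = 1 \<or> s = -1"
  defines "b \<equiv> \<lambda>k. q ^ (3 * k\<^sup>2) * (if k = 0 then 1 else s ^ k * of_nat (lucas (2 * k)))"
  shows "summable b"
    and "(\<lambda>n. q ^ (2 * n\<^sup>2) * (\<Prod>j=1..n. 1 + (3 * s) * q ^ (2 * j - 1) + q ^ (4 * j - 2))
            / qpoch (q\<^sup>2) (q\<^sup>2) (2 * n)) sums (1 / qpoch_inf (q\<^sup>2) (q\<^sup>2) * suminf b)"
proof -
  \<comment> \<open>Halving makes \<open>a 0 = 1\<close>, as \<open>L_0 = 2\<close>; the weight 2
    for \<open>k > 0\<close> undoes it elsewhere. Since \<open>s\<close> is its own inverse, the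
    sign is even in \<open>k\<close> and turns the constant 3 into \<open>3 * s\<close>.\<close>
  define a where "a k = s powi k * of_real (real (lucas (2 * nat \<bar>k\<bar>)) / 2)" for k
  have s': "s \<noteq> 0" "inverse s = s" "norm s = 1" using s by auto
  have rec: "a (k + 1) + a (k - 1) = 3 * s * a k" for k
  proof -
    have "s powi (k + 1) = s * s powi k" "s powi (k - 1) = s * s powi k"
      using s' by (auto simp: power_int_add power_int_diff divide_inverse)
    then have "a (k + 1) + a (k - 1) = s * s powi k * of_real
        ((real (lucas (2 * nat \<bar>k + 1\<bar>)) + real (lucas (2 * nat \<bar>k - 1\<bar>))) / 2)"
      by (simp add: a_def field_simps)
    then show ?thesis
      unfolding lucas_even_bilateral_rec by (simp add: a_def)
  qed
  have even: "a (- k) = a k" for k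
    using s' by (simp add: a_def power_int_minus flip: power_int_inverse)
  have growth: "norm (a (int k)) \<le> 3 ^ k" for k
  proof -
    have "real (lucas (2 * k)) \<le> 2 * 3 ^ k"
      using lucas_even_le[of k] by (metis of_nat_le_iff of_nat_mult of_nat_numeral of_nat_power)
    then show ?thesis
      by (simp add: a_def norm_mult norm_power s')
  qed
  have b: "b = (\<lambda>k. q ^ (3 * k\<^sup>2) * ((if k = 0 then 1 else 2) * a (int k)))"
    by (auto simp: b_def a_def)
  have "a 0 = 1" by (simp add: a_def)
  show "summable b"
    unfolding b by (rule triple_product_sums(1)[OF q rec \<open>a 0 = 1\<close> even growth]) simp
  show "(\<lambda>n. q ^ (2 * n\<^sup>2) * (\<Prod>j=1..n. 1 + (3 * s) * q ^ (2 * j - 1) + q ^ (4 * j - 2))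
            / qpoch (q\<^sup>2) (q\<^sup>2) (2 * n)) sums (1 / qpoch_inf (q\<^sup>2) (q\<^sup>2) * suminf b)"
    unfolding b by (rule triple_product_sums(2)[OF q rec \<open>a 0 = 1\<close> even growth]) simp
qed

theorem theorem4p4:
  fixes q :: complex
  assumes "norm q < 1"
  shows
    "summable (\<lambda>n. q ^ (3 * n\<^sup>2) * of_nat (fib_int (2 * int n + 1) + fib_int (2 * int n - 1))) \<and>
     (\<lambda>n. q ^ (2 * n\<^sup>2) * (\<Prod>j=1..n. 1 + 3 * q ^ (2 * j - 1) + q ^ (4 * j - 2))
            / qpoch (q\<^sup>2) (q\<^sup>2) (2 * n))
       sums (1 / qpoch_inf (q\<^sup>2) (q\<^sup>2) *
         (\<Sum>n. q ^ (3 * n\<^sup>2) * of_nat (fib_int (2 * int n + 1) + fib_int (2 * int n - 1)))) \<and>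
     summable (\<lambda>n. (- 1) ^ Suc n * q ^ (3 * (Suc n)\<^sup>2) * of_nat (lucas (2 * Suc n))) \<and>
     (\<lambda>n. q ^ (2 * n\<^sup>2) * (\<Prod>j=1..n. 1 - 3 * q ^ (2 * j - 1) + q ^ (4 * j - 2))
            / qpoch (q\<^sup>2) (q\<^sup>2) (2 * n))
       sums (1 / qpoch_inf (q\<^sup>2) (q\<^sup>2) *
         (1 + (\<Sum>n. (- 1) ^ Suc n * q ^ (3 * (Suc n)\<^sup>2) * of_nat (lucas (2 * Suc n)))))"
proof -
  \<comment> \<open>At \<open>n = 0\<close> the value 0 for \<open>F_(-1)\<close> gives 1 instead of
    \<open>L_0 = 2\<close>, which matches the halved central term.\<close>
  have fib_lucas: "fib_int (2 * int n + 1) + fib_int (2 * int n - 1) =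
      (if n = 0 then 1 else lucas (2 * n))" for n
  proof (cases n)
    case 0
    then show ?thesis by (simp add: fib_int_def)
  next
    case (Suc m)
    then have "nat (2 * int n + 1) = Suc (Suc (Suc (2 * m)))" "nat (2 * int n - 1) = Suc (2 * m)"
      by auto
    then show ?thesis
      using Suc lucas_eq_fib[of "Suc (2 * m)"] by (simp add: fib_int_def)
  qed
  have first: "q ^ (3 * n\<^sup>2) * of_nat (fib_int (2 * int n + 1) + fib_int (2 * int n - 1)) =
      q ^ (3 * n\<^sup>2) * (if n = 0 then 1 else 1 ^ n * of_nat (lucas (2 * n)))" for n
    unfolding fib_lucas by simp
  note plus = lucas_triple_product_sums[OF assms, of 1, simplified mult_1_right, OF disjI1[OF refl]]
  define b where "b k = q ^ (3 * k\<^sup>2) * (if k = 0 then 1 else (-1) ^ k * of_nat (lucas (2 * k)))" for k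
  have minus: "summable b"
    "(\<lambda>n. q ^ (2 * n\<^sup>2) * (\<Prod>j=1..n. 1 - 3 * q ^ (2 * j - 1) + q ^ (4 * j - 2))
            / qpoch (q\<^sup>2) (q\<^sup>2) (2 * n)) sums (1 / qpoch_inf (q\<^sup>2) (q\<^sup>2) * suminf b)"
    using lucas_triple_product_sums[OF assms, of "-1"] unfolding b_def by simp_all
  have tail: "(- 1) ^ Suc n * q ^ (3 * (Suc n)\<^sup>2) * of_nat (lucas (2 * Suc n)) = b (Suc n)" for n
    unfolding b_def by (simp only: nat.distinct if_False mult_ac)
  \<comment> \<open>The head \<open>b 0\<close> is the separate 1 of the second identity.\<close>
  have "suminf b = 1 + (\<Sum>n. b (Suc n))"
    using suminf_split_head[OF minus(1)] by (simp add: b_def)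
  moreover have "summable (\<lambda>n. b (Suc n))"
    using minus(1) by (simp only: summable_Suc_iff)
  ultimately show ?thesis
    using plus minus(2) unfolding first tail by simp
qed

end
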